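(* Let $\mathcal{V}$ be a finite vocabulary, let $\mathbf{p}_{t,i} = [p_{t,i}(x)]_{x\in\mathcal{V}}$ be the probability distribution on $\mathcal{V}$ produced by worker $i$ at decoding step $t$, and let $1 \le k_i < |\mathcal{V}|$. Let $\mathcal{V}^{(k_i)} \subset \mathcal{V}$ be a set of $k_i$ tokens with the highest probabilities under $\mathbf{p}_{t,i}$, let $\epsilon_{t,i}^{(k_i)} = \sum_{v\notin\mathcal{V}^{(k_i)}} p_{t,i}(v)$, and let $\Delta^{(k_i)}_{t,i} = \|\mathbf{p}^{(k_i)}_{t,i} - \mathbf{p}_{t,i}\|_1$ be the local reconstruction error, where $\mathbf{p}^{(k_i)}_{t,i}$ is the reconstructed distribution. Then: (1) if $\mathbf{p}^{(k_i)}_{t,i}$ is given by renormalized top-$K$ reconstruction, then $$\Delta^{(k_i)}_{t,i} = 2\epsilon_{t,i}^{(k_i)};$$ (2) if $\mathbf{p}^{(k_i)}_{t,i}$ is given by residual-mass redistribution, then $$\Delta^{(k_i)}_{t,i} \le 2\epsilon_{t,i}^{(k_i)}.$$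
   Context: $\|\cdot\|_1$ is the $\ell_1$ norm on $\mathbb{R}^{|\mathcal{V}|}$. The set $\mathcal{V}^{(k_i)}$ consists of $k_i$ tokens of largest probability under $\mathbf{p}_{t,i}$ (ties broken arbitrarily), i.e. $|\mathcal{V}^{(k_i)}| = k_i$ and $p_{t,i}(x) \ge p_{t,i}(y)$ for all $x\in\mathcal{V}^{(k_i)}$, $y\notin\mathcal{V}^{(k_i)}$. The retained mass is $\rho_{t,i} = \sum_{v\in\mathcal{V}^{(k_i)}} p_{t,i}(v)$ and the residual mass is $\epsilon_{t,i} = \epsilon_{t,i}^{(k_i)} = \sum_{v\notin\mathcal{V}^{(k_i)}} p_{t,i}(v) = 1-\rho_{t,i}$. Renormalized top-$K$ reconstruction: $p^{(k_i)}_{t,i}(x) = p_{t,i}(x)/\rho_{t,i}$ for $x\in\mathcal{V}^{(k_i)}$, and $p^{(k_i)}_{t,i}(x) = 0$ for $x\notin\mathcal{V}^{(k_i)}$. Residual-mass redistribution: $p^{(k_i)}_{t,i}(x) = p_{t,i}(x)$ for $x\in\mathcal{V}^{(k_i)}$, and $p^{(k_i)}_{t,i}(x) = \dfrac{\epsilon_{t,i}}{|\mathcal{V}|-k_i}$ for $x\notin\mathcal{V}^{(k_i)}$. *)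

theory Defs
  imports "HOL-Probability.Probability"
begin

text \<open>
  The finite vocabulary is the type \<open>'v\<close> of class \<open>finite\<close>, so complements of token sets are taken
  in the vocabulary and its size is \<open>CARD('v)\<close>. The distribution of one worker at one decoding
  step is a \<open>'v pmf\<close>.
\<close>

definition l1_norm :: "real ^ 'v::finite \<Rightarrow> real"
  where "l1_norm u = (\<Sum>x\<in>UNIV. \<bar>u $ x\<bar>)"

definition prob_vec :: "'v::finite pmf \<Rightarrow> real ^ 'v"
  where "prob_vec p = (\<chi> x. pmf p x)"

text \<open>A predicate rather than a function: ties may be broken arbitrarily.\<close>

definition is_top_set :: "'v::finite pmf \<Rightarrow> nat \<Rightarrow> 'v set \<Rightarrow> bool"
  where "is_top_set p k T \<longleftrightarrow> card T = k \<and> (\<forall>x\<in>T. \<forall>y\<in>- T. pmf p x \<ge> pmf p y)"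

definition retained_mass :: "'v::finite pmf \<Rightarrow> 'v set \<Rightarrow> real"
  where "retained_mass p T = (\<Sum>v\<in>T. pmf p v)"

definition residual_mass :: "'v::finite pmf \<Rightarrow> 'v set \<Rightarrow> real"
  where "residual_mass p T = (\<Sum>v\<in>- T. pmf p v)"

definition renormalized_reconstruction :: "'v::finite pmf \<Rightarrow> 'v set \<Rightarrow> real ^ 'v"
  where "renormalized_reconstruction p T =
    (\<chi> x. if x \<in> T then pmf p x / retained_mass p T else 0)"

definition redistributed_reconstruction :: "'v::finite pmf \<Rightarrow> nat \<Rightarrow> 'v set \<Rightarrow> real ^ 'v"
  where "redistributed_reconstruction p k T =
    (\<chi> x. if x \<in> T then pmf p x else residual_mass p T / (real CARD('v) - real k))"

definition reconstruction_error :: "real ^ 'v::finite \<Rightarrow> 'v pmf \<Rightarrow> real"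
  where "reconstruction_error q p = l1_norm (q - prob_vec p)"

end

theory Submission
  imports Defs
begin

text \<open>Split the l1 distance into its parts on \<open>T\<close> and on \<open>- T\<close>
  (\<open>reconstruction_error_split\<close>), and write r and e for the retained and residual mass,
  so r + e = 1. Renormalizing divides the entries on \<open>T\<close> by r \<le> 1, so none of them
  decreases and the differences there sum to r/r - r = e; off \<open>T\<close> the entries are
  erased, which costs another e. Redistribution is exact on \<open>T\<close>; off \<open>T\<close>
  it compares two nonnegative vectors, each of total mass e, so their distance is at most
  2e.\<close>

lemma retained_plus_residual: "retained_mass p T + residual_mass p T = 1"
proof -
  have "(\<Sum>v\<in>T. pmf p v) + (\<Sum>v\<in>- T. pmf p v) = (\<Sum>v\<in>UNIV. pmf p v)"
    by (subst sum.union_disjoint [symmetric]) (auto simp: Compl_partition)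
  also have "\<dots> = 1"
    by (rule sum_pmf_eq_1) auto
  finally show ?thesis
    by (simp add: retained_mass_def residual_mass_def)
qed

lemma residual_mass_nonneg: "0 \<le> residual_mass p T"
  by (simp add: residual_mass_def sum_nonneg)

text \<open>This is where the ordering of the probabilities enters: a token of \<open>T\<close> with
  probability 0 dominates every token outside \<open>T\<close>, so if \<open>T\<close> carried no
  mass, the whole distribution would vanish.\<close>

lemma retained_mass_pos:
  assumes "is_top_set p k T" and "1 \<le> k"
  shows "0 < retained_mass p T"
proof (rule ccontr)
  assume "\<not> 0 < retained_mass p T"
  moreover have "0 \<le> retained_mass p T"
    by (simp add: retained_mass_def sum_nonneg)
  ultimately have zero: "retained_mass p T = 0"
    by simp
  then have T0: "pmf p x = 0" if "x \<in> T" for x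
    using that by (simp add: retained_mass_def sum_nonneg_eq_0_iff)
  from assms have "T \<noteq> {}"
    by (auto simp: is_top_set_def)
  then obtain x where "x \<in> T"
    by blast
  have "pmf p y = 0" if "y \<in> - T" for y
    using assms(1) \<open>x \<in> T\<close> that T0[OF \<open>x \<in> T\<close>] pmf_nonneg[of p y]
    by (force simp: is_top_set_def)
  then have "residual_mass p T = 0"
    by (simp add: residual_mass_def)
  with zero retained_plus_residual[of p T] show False
    by simp
qed

lemma reconstruction_error_split:
  "reconstruction_error q p = (\<Sum>x\<in>T. \<bar>q $ x - pmf p x\<bar>) + (\<Sum>x\<in>- T. \<bar>q $ x - pmf p x\<bar>)"
  unfolding reconstruction_error_def l1_norm_def prob_vec_def
  by (subst sum.union_disjoint [symmetric]) (auto simp: Compl_partition)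

text \<open>Positivity matters for the equality: with retained mass 0, the convention x / 0 = 0
  would give the zero vector, whose error is 1 and not 2.\<close>

lemma renormalized_reconstruction_error:
  assumes "0 < retained_mass p T"
  shows "reconstruction_error (renormalized_reconstruction p T) p = 2 * residual_mass p T"
proof -
  let ?r = "retained_mass p T"
  have le1: "?r \<le> 1"
    using retained_plus_residual[of p T] residual_mass_nonneg[of p T] by simp
  have "(\<Sum>x\<in>T. \<bar>renormalized_reconstruction p T $ x - pmf p x\<bar>) = (\<Sum>x\<in>T. pmf p x / ?r - pmf p x)"
  proof (rule sum.cong)
    fix x assume "x \<in> T"
    have "pmf p x * ?r \<le> pmf p x"
      using le1 by (simp add: mult_left_le)
    then have "pmf p x \<le> pmf p x / ?r"
      using assms by (simp add: pos_le_divide_eq)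
    with \<open>x \<in> T\<close> show "\<bar>renormalized_reconstruction p T $ x - pmf p x\<bar> = pmf p x / ?r - pmf p x"
      by (simp add: renormalized_reconstruction_def)
  qed simp
  also have "\<dots> = (\<Sum>x\<in>T. pmf p x) / ?r - (\<Sum>x\<in>T. pmf p x)"
    by (simp add: sum_subtractf sum_divide_distrib)
  \<comment> \<open>The kept entries gain r/r - r = 1 - r, exactly the mass lost outside
    \<open>T\<close>.\<close>
  also have "\<dots> = residual_mass p T"
    using assms retained_plus_residual[of p T] by (simp add: retained_mass_def)
  finally show ?thesis
    by (simp add: reconstruction_error_split[of _ _ T] renormalized_reconstruction_def
        residual_mass_def)
qed

lemma redistributed_reconstruction_error_le:
  fixes p :: "'v::finite pmf"
  assumes "card T = k" and "k < CARD('v)"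
  shows "reconstruction_error (redistributed_reconstruction p k T) p \<le> 2 * residual_mass p T"
proof -
  let ?c = "residual_mass p T / (real CARD('v) - real k)"
  have card: "real (card (- T)) = real CARD('v) - real k"
    using assms by (simp add: Compl_eq_Diff_UNIV card_Diff_subset of_nat_diff)
  have "0 \<le> ?c"
    using assms residual_mass_nonneg[of p T] by simp
  \<comment> \<open>Triangle inequality for two nonnegative numbers; it is the only loss in the
    bound.\<close>
  then have "\<bar>?c - pmf p x\<bar> \<le> ?c + pmf p x" for x
    using pmf_nonneg[of p x] by linarith
  then have "(\<Sum>x\<in>- T. \<bar>?c - pmf p x\<bar>) \<le> (\<Sum>x\<in>- T. ?c + pmf p x)"
    by (intro sum_mono)
  also have "\<dots> = real (card (- T)) * ?c + residual_mass p T"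
    by (simp add: sum.distrib residual_mass_def)
  \<comment> \<open>Since \<open>k < CARD('v)\<close>, the denominator of \<open>?c\<close> is
    nonzero and cancels against the size of \<open>- T\<close>.\<close>
  also have "\<dots> = 2 * residual_mass p T"
    using assms by (simp add: card)
  finally show ?thesis
    by (simp add: reconstruction_error_split[of _ _ T] redistributed_reconstruction_def)
qed

theorem lemma1:
  fixes p :: "'v::finite pmf" and k :: nat and T :: "'v set"
  assumes "1 \<le> k" and "k < CARD('v)"
    and "is_top_set p k T"
  shows "reconstruction_error (renormalized_reconstruction p T) p = 2 * residual_mass p T
    \<and> reconstruction_error (redistributed_reconstruction p k T) p \<le> 2 * residual_mass p T"
proof
  show "reconstruction_error (renormalized_reconstruction p T) p = 2 * residual_mass p T"
    using retained_mass_pos[OF assms(3,1)] by (rule renormalized_reconstruction_error)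
  from assms(3) have "card T = k"
    by (simp add: is_top_set_def)
  then show "reconstruction_error (redistributed_reconstruction p k T) p \<le> 2 * residual_mass p T"
    using assms(2) by (rule redistributed_reconstruction_error_le)
qed

end
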